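(* Consider preference statements over a finite variable set $V$ with inference based on lexicographic models. Let $\vec{0}$ be the alternative assigning $0$ to every variable, $\vec{0}_v$ the alternative assigning $1$ to $v$ and $0$ to all other variables, $\vec{1}$ the alternative assigning $1$ to every variable, and $\vec{1}_v$ the alternative assigning $0$ to $v$ and $1$ to all other variables. Let $\Phi_1,\ldots,\Phi_n$ be non-trivial sets of statements. There exists a middle ground for $\Phi_1,\ldots,\Phi_n$ if and only if some statement in $\{\vec{1}_v\geq\vec{0}_v\mid v\in V\}\cup\{\vec{1}_v>\vec{0}\mid v\in V\}$ satisfies (P3) and (P4).
   Context: Each variable $v\in V$ has a finite totally ordered domain $\underline{v}$ with more than one element, containing values $0$ and $1$ with $1>0$; alternatives are elements $\alpha\in\underline{V}=\prod_{v\in V}\underline{v}$. A lexicographic model is a non-empty sequence $\pi=(v_1,\ldots,v_k)$ of variables in $V$. $\pi\models\alpha\geq\beta$ iff either $\alpha(v_i)=\beta(v_i)$ for all $i$, or there is $i$ with $\alpha(v_i)>\beta(v_i)$ and $\alpha(v_j)=\beta(v_j)$ for all $j<i$; $\pi\models\alpha>\beta$ iff the latter condition holds. The language $\mathcal{L}$ consists of all statements $\alpha\geq\beta$ and $\alpha>\beta$ for $\alpha,\beta\in\underline{V}$. For $\Phi\subseteq\mathcal{L}$: $\pi\models\Phi$ iff $\pi$ satisfies every element; $\Phi\models\Phi'$ iff every lexicographic model of $\Phi$ is a model of $\Phi'$; $\Phi\equiv\Phi'$ iff mutual entailment; $\Phi$ is consistent if it has a lexicographic model, falsifiable if some lexicographic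 model does not satisfy it, non-trivial if both. Given non-trivial $\Phi_1,\ldots,\Phi_n$, $\Phi\subseteq\mathcal{L}$ is a middle ground if: (P1) $\Phi$ non-trivial; (P2) if $\bigcup_i\Phi_i$ is consistent then $\Phi\equiv\bigcup_i\Phi_i$; (P3) for each $\phi\in\Phi$, each $i$ and each $\phi_i\in\Phi_i$ some lexicographic model satisfies both $\phi$ and $\phi_i$; (P4) each $\phi\in\Phi$ is entailed by some $\Phi_i$; (P5) no $\Phi'\subseteq\mathcal{L}$ satisfying (P1)–(P4) has $\Phi'\models\Phi$ and $\Phi\not\models\Phi'$. A single statement satisfies (P3)/(P4) if the singleton set of it does. *)

theory Defs
  imports Main "HOL-Library.FuncSet"
begin

text \<open>
  Every variable carries its own finite domain \<open>D v\<close> and its own total order \<open>R v\<close>, where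
  \<open>(x, y) \<in> R v\<close> means \<open>x \<le> y\<close>; the orders of different variables are unrelated, and \<open>0\<close>
  and \<open>1\<close> need not be the extreme elements.
\<close>

definition val_gt :: "('v \<Rightarrow> 'd rel) \<Rightarrow> 'v \<Rightarrow> 'd \<Rightarrow> 'd \<Rightarrow> bool" where
  "val_gt R v x y \<longleftrightarrow> (y, x) \<in> R v \<and> x \<noteq> y"

definition pref_domains ::
    "'v set \<Rightarrow> ('v \<Rightarrow> 'd::{zero,one} set) \<Rightarrow> ('v \<Rightarrow> 'd rel) \<Rightarrow> bool" where
  "pref_domains V D R \<longleftrightarrow> finite V \<and>
     (\<forall>v\<in>V. finite (D v) \<and> card (D v) > 1 \<and> linear_order_on (D v) (R v) \<and>
        0 \<in> D v \<and> 1 \<in> D v \<and> val_gt R v 1 0)"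

definition alternatives :: "'v set \<Rightarrow> ('v \<Rightarrow> 'd set) \<Rightarrow> ('v \<Rightarrow> 'd) set" where
  "alternatives V D = (\<Pi>\<^sub>E v\<in>V. D v)"

datatype 'a statement = Geq 'a 'a | Gt 'a 'a

definition language :: "'v set \<Rightarrow> ('v \<Rightarrow> 'd set) \<Rightarrow> ('v \<Rightarrow> 'd) statement set" where
  "language V D =
     {Geq \<alpha> \<beta> | \<alpha> \<beta>. \<alpha> \<in> alternatives V D \<and> \<beta> \<in> alternatives V D} \<union>
     {Gt \<alpha> \<beta> | \<alpha> \<beta>. \<alpha> \<in> alternatives V D \<and> \<beta> \<in> alternatives V D}"

text \<open>Repetitions in the sequence are permitted.\<close>

definition lex_models :: "'v set \<Rightarrow> 'v list set" where
  "lex_models V = {\<pi>. \<pi> \<noteq> [] \<and> set \<pi> \<subseteq> V}"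

definition lex_gt :: "('v \<Rightarrow> 'd rel) \<Rightarrow> 'v list \<Rightarrow> ('v \<Rightarrow> 'd) \<Rightarrow> ('v \<Rightarrow> 'd) \<Rightarrow> bool" where
  "lex_gt R \<pi> \<alpha> \<beta> \<longleftrightarrow>
     (\<exists>i<length \<pi>. val_gt R (\<pi> ! i) (\<alpha> (\<pi> ! i)) (\<beta> (\<pi> ! i)) \<and>
        (\<forall>j<i. \<alpha> (\<pi> ! j) = \<beta> (\<pi> ! j)))"

fun sat :: "('v \<Rightarrow> 'd rel) \<Rightarrow> 'v list \<Rightarrow> ('v \<Rightarrow> 'd) statement \<Rightarrow> bool" where
  "sat R \<pi> (Geq \<alpha> \<beta>) \<longleftrightarrow> (\<forall>i<length \<pi>. \<alpha> (\<pi> ! i) = \<beta> (\<pi> ! i)) \<or> lex_gt R \<pi> \<alpha> \<beta>"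
| "sat R \<pi> (Gt \<alpha> \<beta>) \<longleftrightarrow> lex_gt R \<pi> \<alpha> \<beta>"

definition sat_set :: "('v \<Rightarrow> 'd rel) \<Rightarrow> 'v list \<Rightarrow> ('v \<Rightarrow> 'd) statement set \<Rightarrow> bool" where
  "sat_set R \<pi> \<Phi> \<longleftrightarrow> (\<forall>\<phi>\<in>\<Phi>. sat R \<pi> \<phi>)"

definition entails ::
    "'v set \<Rightarrow> ('v \<Rightarrow> 'd rel) \<Rightarrow> ('v \<Rightarrow> 'd) statement set \<Rightarrow> ('v \<Rightarrow> 'd) statement set \<Rightarrow> bool" where
  "entails V R \<Phi> \<Phi>' \<longleftrightarrow> (\<forall>\<pi>\<in>lex_models V. sat_set R \<pi> \<Phi> \<longrightarrow> sat_set R \<pi> \<Phi>')"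

definition equivalent ::
    "'v set \<Rightarrow> ('v \<Rightarrow> 'd rel) \<Rightarrow> ('v \<Rightarrow> 'd) statement set \<Rightarrow> ('v \<Rightarrow> 'd) statement set \<Rightarrow> bool" where
  "equivalent V R \<Phi> \<Phi>' \<longleftrightarrow> entails V R \<Phi> \<Phi>' \<and> entails V R \<Phi>' \<Phi>"

definition consistent :: "'v set \<Rightarrow> ('v \<Rightarrow> 'd rel) \<Rightarrow> ('v \<Rightarrow> 'd) statement set \<Rightarrow> bool" where
  "consistent V R \<Phi> \<longleftrightarrow> (\<exists>\<pi>\<in>lex_models V. sat_set R \<pi> \<Phi>)"

definition falsifiable :: "'v set \<Rightarrow> ('v \<Rightarrow> 'd rel) \<Rightarrow> ('v \<Rightarrow> 'd) statement set \<Rightarrow> bool" where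
  "falsifiable V R \<Phi> \<longleftrightarrow> (\<exists>\<pi>\<in>lex_models V. \<not> sat_set R \<pi> \<Phi>)"

definition nontrivial :: "'v set \<Rightarrow> ('v \<Rightarrow> 'd rel) \<Rightarrow> ('v \<Rightarrow> 'd) statement set \<Rightarrow> bool" where
  "nontrivial V R \<Phi> \<longleftrightarrow> consistent V R \<Phi> \<and> falsifiable V R \<Phi>"

text \<open>
  The given sets are \<open>\<Psi> 1, \<dots>, \<Psi> n\<close>; the values of \<open>\<Psi>\<close> at other indices are irrelevant.
\<close>

definition P1 :: "'v set \<Rightarrow> ('v \<Rightarrow> 'd rel) \<Rightarrow> ('v \<Rightarrow> 'd) statement set \<Rightarrow> bool" where
  "P1 V R \<Phi> \<longleftrightarrow> nontrivial V R \<Phi>"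

definition P2 ::
    "'v set \<Rightarrow> ('v \<Rightarrow> 'd rel) \<Rightarrow> nat \<Rightarrow> (nat \<Rightarrow> ('v \<Rightarrow> 'd) statement set) \<Rightarrow>
     ('v \<Rightarrow> 'd) statement set \<Rightarrow> bool" where
  "P2 V R n \<Psi> \<Phi> \<longleftrightarrow>
     (consistent V R (\<Union>i\<in>{1..n}. \<Psi> i) \<longrightarrow> equivalent V R \<Phi> (\<Union>i\<in>{1..n}. \<Psi> i))"

definition P3 ::
    "'v set \<Rightarrow> ('v \<Rightarrow> 'd rel) \<Rightarrow> nat \<Rightarrow> (nat \<Rightarrow> ('v \<Rightarrow> 'd) statement set) \<Rightarrow>
     ('v \<Rightarrow> 'd) statement set \<Rightarrow> bool" where
  "P3 V R n \<Psi> \<Phi> \<longleftrightarrow>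
     (\<forall>\<phi>\<in>\<Phi>. \<forall>i\<in>{1..n}. \<forall>\<psi>\<in>\<Psi> i. \<exists>\<pi>\<in>lex_models V. sat R \<pi> \<phi> \<and> sat R \<pi> \<psi>)"

definition P4 ::
    "'v set \<Rightarrow> ('v \<Rightarrow> 'd rel) \<Rightarrow> nat \<Rightarrow> (nat \<Rightarrow> ('v \<Rightarrow> 'd) statement set) \<Rightarrow>
     ('v \<Rightarrow> 'd) statement set \<Rightarrow> bool" where
  "P4 V R n \<Psi> \<Phi> \<longleftrightarrow> (\<forall>\<phi>\<in>\<Phi>. \<exists>i\<in>{1..n}. entails V R (\<Psi> i) {\<phi>})"

definition P5 ::
    "'v set \<Rightarrow> ('v \<Rightarrow> 'd set) \<Rightarrow> ('v \<Rightarrow> 'd rel) \<Rightarrow> nat \<Rightarrow>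
     (nat \<Rightarrow> ('v \<Rightarrow> 'd) statement set) \<Rightarrow> ('v \<Rightarrow> 'd) statement set \<Rightarrow> bool" where
  "P5 V D R n \<Psi> \<Phi> \<longleftrightarrow>
     \<not> (\<exists>\<Phi>'\<subseteq>language V D.
          P1 V R \<Phi>' \<and> P2 V R n \<Psi> \<Phi>' \<and> P3 V R n \<Psi> \<Phi>' \<and> P4 V R n \<Psi> \<Phi>' \<and>
          entails V R \<Phi>' \<Phi> \<and> \<not> entails V R \<Phi> \<Phi>')"

definition middle_ground ::
    "'v set \<Rightarrow> ('v \<Rightarrow> 'd set) \<Rightarrow> ('v \<Rightarrow> 'd rel) \<Rightarrow> nat \<Rightarrow>
     (nat \<Rightarrow> ('v \<Rightarrow> 'd) statement set) \<Rightarrow> ('v \<Rightarrow> 'd) statement set \<Rightarrow> bool" where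
  "middle_ground V D R n \<Psi> \<Phi> \<longleftrightarrow> \<Phi> \<subseteq> language V D \<and>
     P1 V R \<Phi> \<and> P2 V R n \<Psi> \<Phi> \<and> P3 V R n \<Psi> \<Phi> \<and> P4 V R n \<Psi> \<Phi> \<and> P5 V D R n \<Psi> \<Phi>"

definition alt_zero :: "'v set \<Rightarrow> 'v \<Rightarrow> 'd::{zero,one}" where
  "alt_zero V = (\<lambda>u\<in>V. 0)"

definition alt_zero_at :: "'v set \<Rightarrow> 'v \<Rightarrow> 'v \<Rightarrow> 'd::{zero,one}" where
  "alt_zero_at V v = (\<lambda>u\<in>V. if u = v then 1 else 0)"

definition alt_one_at :: "'v set \<Rightarrow> 'v \<Rightarrow> 'v \<Rightarrow> 'd::{zero,one}" where
  "alt_one_at V v = (\<lambda>u\<in>V. if u = v then 0 else 1)"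

end

theory Submission
  imports Defs
begin

text \<open>
  \<open>1\<^sub>v \<ge> 0\<^sub>v\<close> says that a model does not start with \<open>v\<close>, and \<open>1\<^sub>v > 0\<close> says that it is not
  \<open>(v)\<close> up to repetitions. These are the weakest falsifiable statements: if
  \<open>\<beta> v > \<alpha> v\<close> for some \<open>v\<close>, then models of \<open>\<alpha> \<ge> \<beta>\<close> or \<open>\<alpha> > \<beta>\<close> cannot start with \<open>v\<close>;
  otherwise \<open>\<alpha> \<ge> \<beta>\<close> is a tautology and \<open>\<alpha> > \<beta>\<close> fails only where \<open>\<alpha>\<close> and \<open>\<beta>\<close> agree, so its
  models are not \<open>(v)\<close> for any \<open>v\<close> with \<open>\<alpha> v = \<beta> v\<close>. Since (P3) and (P4) pass to weaker statements,
  the falsifiable member of a middle ground yields one of the listed statements.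
  Conversely, the union of the given sets is a middle ground if it is consistent, and otherwise
  the singleton of the listed statement satisfies (P1)--(P4); the language being finite, a
  strongest set with these properties exists.
\<close>

lemma val_gt_total:
  assumes "pref_domains V D R" "v \<in> V" "x \<in> D v" "y \<in> D v" "x \<noteq> y"
  shows "val_gt R v x y \<or> val_gt R v y x"
  using assms unfolding pref_domains_def linear_order_on_def total_on_def val_gt_def by blast

lemma val_gt_asym:
  assumes "pref_domains V D R" "v \<in> V" "val_gt R v x y"
  shows "\<not> val_gt R v y x"
  using assms unfolding pref_domains_def linear_order_on_def partial_order_on_def
    antisym_def val_gt_def by blast

lemma val_gt_one_zero:
  fixes D :: "'v \<Rightarrow> 'd::{zero,one} set"
  assumes "pref_domains V D R" "v \<in> V"
  shows "val_gt R v 1 0" "\<not> val_gt R v 0 1" "1 \<noteq> (0::'d)"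
  using assms val_gt_asym[OF assms, of 1 0] unfolding pref_domains_def val_gt_def by auto

lemma lex_gt_Nil [simp]: "\<not> lex_gt R [] \<alpha> \<beta>"
  by (simp add: lex_gt_def)

lemma lex_gt_Cons [simp]:
  "lex_gt R (u # \<pi>) \<alpha> \<beta> \<longleftrightarrow> val_gt R u (\<alpha> u) (\<beta> u) \<or> \<alpha> u = \<beta> u \<and> lex_gt R \<pi> \<alpha> \<beta>"
  unfolding lex_gt_def by (simp add: Ex_less_Suc2 All_less_Suc2) blast

lemma sat_Geq_iff:
  "sat R \<pi> (Geq \<alpha> \<beta>) \<longleftrightarrow> (\<forall>u\<in>set \<pi>. \<alpha> u = \<beta> u) \<or> lex_gt R \<pi> \<alpha> \<beta>"
  by (simp add: all_set_conv_all_nth)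

lemma lex_gt_imp_differ: "lex_gt R \<pi> \<alpha> \<beta> \<Longrightarrow> \<exists>u\<in>set \<pi>. \<alpha> u \<noteq> \<beta> u"
  by (auto simp: lex_gt_def val_gt_def)

text \<open>By totality, a first disagreement along \<open>\<pi>\<close> would favour \<alpha> and
  so witness \<open>lex_gt\<close>; the induction rules it out entry by entry.\<close>

lemma not_lex_gt_imp_agree:
  assumes "pref_domains V D R" "\<alpha> \<in> alternatives V D" "\<beta> \<in> alternatives V D"
    and "\<forall>v\<in>V. \<not> val_gt R v (\<beta> v) (\<alpha> v)"
    and "set \<pi> \<subseteq> V" "\<not> lex_gt R \<pi> \<alpha> \<beta>"
  shows "\<forall>u\<in>set \<pi>. \<alpha> u = \<beta> u"
  using assms(5,6)
proof (induction \<pi>)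
  case (Cons u \<pi>)
  have "\<alpha> u \<in> D u" "\<beta> u \<in> D u"
    using assms(2,3) Cons.prems(1) by (auto simp: alternatives_def)
  then have "\<alpha> u = \<beta> u"
    using val_gt_total[OF assms(1), of u "\<alpha> u" "\<beta> u"] assms(4) Cons.prems by auto
  then show ?case
    using Cons by simp
qed simp

text \<open>The two alternatives differ at every variable of \<open>V\<close>, and only at
  \<open>v\<close> in favour of the second, so the first entry of \<open>\<pi>\<close> alone
  decides.\<close>

lemma sat_one_at_Geq_iff:
  fixes D :: "'v \<Rightarrow> 'd::{zero,one} set"
  assumes "pref_domains V D R" "\<pi> \<in> lex_models V"
  shows "sat R \<pi> (Geq (alt_one_at V v) (alt_zero_at V v)) \<longleftrightarrow> hd \<pi> \<noteq> v"
proof -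
  obtain u \<rho> where \<pi>: "\<pi> = u # \<rho>" "u \<in> V"
    using assms(2) by (cases \<pi>) (auto simp: lex_models_def)
  then show ?thesis
    using val_gt_one_zero[OF assms(1) \<open>u \<in> V\<close>]
    by (auto simp: sat_Geq_iff alt_one_at_def alt_zero_at_def simp del: sat.simps(1))
qed

text \<open>Both alternatives are 0 at \<open>v\<close>, while the first is better at every other
  variable of \<open>V\<close>: entries equal to \<open>v\<close> are skipped and the first other
  entry decides.\<close>

lemma sat_one_at_Gt_iff:
  fixes D :: "'v \<Rightarrow> 'd::{zero,one} set"
  assumes "pref_domains V D R" "\<pi> \<in> lex_models V"
  shows "sat R \<pi> (Gt (alt_one_at V v) (alt_zero V)) \<longleftrightarrow> (\<exists>u\<in>set \<pi>. u \<noteq> v)"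
proof -
  have "set \<pi> \<subseteq> V"
    using assms(2) by (simp add: lex_models_def)
  then have "lex_gt R \<pi> (alt_one_at V v) (alt_zero V :: 'v \<Rightarrow> 'd) \<longleftrightarrow> (\<exists>u\<in>set \<pi>. u \<noteq> v)"
  proof (induction \<pi>)
    case (Cons u \<pi>)
    then show ?case
      using val_gt_one_zero[OF assms(1), of u]
      by (cases "u = v") (auto simp: alt_one_at_def alt_zero_def val_gt_def)
  qed simp
  then show ?thesis by simp
qed

lemma singleton_in_lex_models: "v \<in> V \<Longrightarrow> [v] \<in> lex_models V"
  by (simp add: lex_models_def)

definition weakest_statements :: "'v set \<Rightarrow> ('v \<Rightarrow> 'd::{zero,one}) statement set" where
  "weakest_statements V = {Geq (alt_one_at V v) (alt_zero_at V v) | v. v \<in> V} \<union>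
     {Gt (alt_one_at V v) (alt_zero V) | v. v \<in> V}"

lemma weakest_statements_language:
  assumes "pref_domains V D R"
  shows "weakest_statements V \<subseteq> language V D"
  using assms unfolding weakest_statements_def language_def alternatives_def pref_domains_def
  by (auto simp: alt_one_at_def alt_zero_at_def alt_zero_def)

lemma weakest_statements_falsifiable:
  assumes "pref_domains V D R" "\<phi> \<in> weakest_statements V"
  shows "falsifiable V R {\<phi>}"
proof -
  obtain v where "v \<in> V" "\<phi> = Geq (alt_one_at V v) (alt_zero_at V v) \<or>
      \<phi> = Gt (alt_one_at V v) (alt_zero V)"
    using assms(2) unfolding weakest_statements_def by blast
  then have "\<not> sat R [v] \<phi>"
    using sat_one_at_Geq_iff[OF assms(1), of "[v]" v] sat_one_at_Gt_iff[OF assms(1), of "[v]" v]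
      singleton_in_lex_models[of v V] by auto
  then show ?thesis
    using singleton_in_lex_models[OF \<open>v \<in> V\<close>] by (auto simp: falsifiable_def sat_set_def)
qed

lemma falsifiable_entails_weakest:
  assumes dom: "pref_domains V D R" and lang: "\<phi> \<in> language V D"
    and \<pi>: "\<pi> \<in> lex_models V" "\<not> sat R \<pi> \<phi>"
  shows "\<exists>\<chi>\<in>weakest_statements V. entails V R {\<phi>} {\<chi>}"
proof -
  obtain \<alpha> \<beta> where \<phi>: "\<phi> = Geq \<alpha> \<beta> \<or> \<phi> = Gt \<alpha> \<beta>"
    and alt: "\<alpha> \<in> alternatives V D" "\<beta> \<in> alternatives V D"
    using lang unfolding language_def by blast
  show ?thesis
  proof (cases "\<exists>v\<in>V. val_gt R v (\<beta> v) (\<alpha> v)")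
    case True
    then obtain v where v: "v \<in> V" "val_gt R v (\<beta> v) (\<alpha> v)" by blast
    have "hd \<rho> \<noteq> v" if \<rho>: "\<rho> \<in> lex_models V" "sat R \<rho> \<phi>" for \<rho>
    proof
      assume "hd \<rho> = v"
      then obtain \<sigma> where "\<rho> = v # \<sigma>"
        using \<rho>(1) by (cases \<rho>) (auto simp: lex_models_def)
      then show False
        using \<rho>(2) \<phi> v val_gt_asym[OF dom v]
        by (auto simp: sat_Geq_iff val_gt_def simp del: sat.simps(1))
    qed
    then have "entails V R {\<phi>} {Geq (alt_one_at V v) (alt_zero_at V v)}"
      using sat_one_at_Geq_iff[OF dom] by (simp add: entails_def sat_set_def del: sat.simps)
    then show ?thesis
      using v(1) unfolding weakest_statements_def by blast
  next
    case False
    have "\<not> lex_gt R \<pi> \<alpha> \<beta>"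
      using \<pi>(2) \<phi> by auto
    then have agree: "\<forall>u\<in>set \<pi>. \<alpha> u = \<beta> u"
      using not_lex_gt_imp_agree[OF dom alt] False \<pi>(1) by (auto simp: lex_models_def)
    \<comment> \<open>Agreement along all of \<open>\<pi>\<close> would satisfy the
      \<open>Geq\<close> form, which \<open>\<pi>\<close> falsifies.\<close>
    then have Gt: "\<phi> = Gt \<alpha> \<beta>"
      using \<phi> \<pi>(2) sat_Geq_iff by blast
    \<comment> \<open>Any entry of \<open>\<pi>\<close> would serve; the head exists because models
      are non-empty. A model of \<open>\<phi>\<close> contains a variable where \<alpha> and \<beta>
      differ, hence one other than \<open>v\<close>.\<close>
    define v where "v = hd \<pi>"
    have v: "v \<in> V" "\<alpha> v = \<beta> v"
      using \<pi>(1) agree by (auto simp: lex_models_def v_def)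
    have "\<exists>u\<in>set \<rho>. u \<noteq> v" if "sat R \<rho> \<phi>" for \<rho>
      using that lex_gt_imp_differ[of R \<rho> \<alpha> \<beta>] v(2) Gt by auto
    then have "entails V R {\<phi>} {Gt (alt_one_at V v) (alt_zero V)}"
      using sat_one_at_Gt_iff[OF dom] by (simp add: entails_def sat_set_def del: sat.simps)
    then show ?thesis
      using v(1) unfolding weakest_statements_def by blast
  qed
qed

lemma P3_weaken:
  assumes "P3 V R n \<Psi> {\<phi>}" "entails V R {\<phi>} {\<chi>}"
  shows "P3 V R n \<Psi> {\<chi>}"
proof -
  have "\<exists>\<pi>\<in>lex_models V. sat R \<pi> \<chi> \<and> sat R \<pi> \<psi>" if "i \<in> {1..n}" "\<psi> \<in> \<Psi> i" for i \<psi>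
  proof -
    obtain \<pi> where "\<pi> \<in> lex_models V" "sat R \<pi> \<phi>" "sat R \<pi> \<psi>"
      using assms(1) \<open>i \<in> {1..n}\<close> \<open>\<psi> \<in> \<Psi> i\<close> unfolding P3_def by blast
    then show ?thesis
      using assms(2) unfolding entails_def sat_set_def by blast
  qed
  then show ?thesis
    by (simp add: P3_def)
qed

lemma P4_weaken: "P4 V R n \<Psi> {\<phi>} \<Longrightarrow> entails V R {\<phi>} {\<chi>} \<Longrightarrow> P4 V R n \<Psi> {\<chi>}"
  unfolding P4_def entails_def by simp blast

lemma finite_language:
  assumes "pref_domains V D R"
  shows "finite (language V D)"
proof -
  let ?A = "alternatives V D"
  have "finite ?A"
    using assms unfolding pref_domains_def alternatives_def by (auto intro: finite_PiE)
  moreover have "language V D \<subseteq> case_prod Geq ` (?A \<times> ?A) \<union> case_prod Gt ` (?A \<times> ?A)"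
    unfolding language_def by auto
  ultimately show ?thesis
    by (meson finite_SigmaI finite_UnI finite_imageI finite_subset)
qed

text \<open>Entailment is only a preorder, so strength is measured by the number of consequences
  within the finite set \<open>L\<close>; a set maximizing this number is strongest.\<close>

lemma exists_strongest:
  assumes "finite L" "Q \<Phi>\<^sub>0" "\<And>\<Phi>. Q \<Phi> \<Longrightarrow> \<Phi> \<subseteq> L"
  shows "\<exists>\<Phi>. Q \<Phi> \<and> (\<forall>\<Phi>'. Q \<Phi>' \<longrightarrow> entails V R \<Phi>' \<Phi> \<longrightarrow> entails V R \<Phi> \<Phi>')"
proof -
  define T where "T \<Phi> = {\<psi> \<in> L. entails V R \<Phi> {\<psi>}}" for \<Phi>
  have fin: "finite (T \<Phi>)" for \<Phi>
    using assms(1) by (simp add: T_def)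
  \<comment> \<open>\<open>ex_has_greatest_nat\<close> takes a strict upper bound, hence the
    \<open>Suc\<close>.\<close>
  have "\<forall>\<Phi>. Q \<Phi> \<longrightarrow> card (T \<Phi>) < Suc (card L)"
    using assms(1) by (simp add: T_def card_mono less_Suc_eq_le)
  from ex_has_greatest_nat[OF assms(2) this]
  obtain \<Phi> where \<Phi>: "Q \<Phi>" "\<And>\<Phi>'. Q \<Phi>' \<Longrightarrow> card (T \<Phi>') \<le> card (T \<Phi>)"
    by blast
  have "entails V R \<Phi> \<Phi>'" if Q: "Q \<Phi>'" and ent: "entails V R \<Phi>' \<Phi>" for \<Phi>'
  proof -
    have "T \<Phi> \<subseteq> T \<Phi>'"
      using ent by (auto simp: T_def entails_def)
    then have "T \<Phi> = T \<Phi>'"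
      using \<Phi>(2)[OF Q] fin by (simp add: card_seteq)
    \<comment> \<open>Members of \<open>\<Phi>'\<close> are among its own consequences, which are
      now also those of \<open>\<Phi>\<close>.\<close>
    moreover have "\<Phi>' \<subseteq> T \<Phi>'"
      using assms(3)[OF Q] by (auto simp: T_def entails_def sat_set_def)
    ultimately show ?thesis
      by (auto simp: T_def entails_def sat_set_def)
  qed
  with \<Phi>(1) show ?thesis by blast
qed

lemma middle_ground_union:
  assumes lang: "\<And>i. i \<in> {1..n} \<Longrightarrow> \<Psi> i \<subseteq> language V D"
    and nontriv: "\<And>i. i \<in> {1..n} \<Longrightarrow> nontrivial V R (\<Psi> i)"
    and "n \<ge> 1" and cons: "consistent V R (\<Union>i\<in>{1..n}. \<Psi> i)"
  shows "middle_ground V D R n \<Psi> (\<Union>i\<in>{1..n}. \<Psi> i)"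
proof -
  let ?U = "\<Union>i\<in>{1..n}. \<Psi> i"
  \<comment> \<open>The union inherits falsifiability from any one of its parts.\<close>
  have "falsifiable V R (\<Psi> 1)"
    using nontriv[of 1] \<open>n \<ge> 1\<close> by (simp add: nontrivial_def)
  then have "P1 V R ?U"
    using cons \<open>n \<ge> 1\<close> unfolding P1_def nontrivial_def falsifiable_def sat_set_def by fastforce
  moreover have "P2 V R n \<Psi> ?U"
    by (simp add: P2_def equivalent_def entails_def)
  moreover have "P3 V R n \<Psi> ?U"
    using cons unfolding P3_def consistent_def sat_set_def by blast
  moreover have "P4 V R n \<Psi> ?U"
    unfolding P4_def entails_def sat_set_def by blast
  \<comment> \<open>As the union is consistent, (P2) makes every competitor equivalent to it, so
    none is strictly stronger.\<close>
  moreover have "P5 V D R n \<Psi> ?U"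
    using cons unfolding P5_def P2_def equivalent_def by blast
  ultimately show ?thesis
    using lang unfolding middle_ground_def by blast
qed

theorem theorem15:
  fixes V :: "'v set"
    and D :: "'v \<Rightarrow> 'd::{zero,one} set"
    and R :: "'v \<Rightarrow> 'd rel"
    and n :: nat
    and \<Psi> :: "nat \<Rightarrow> ('v \<Rightarrow> 'd) statement set"
  assumes "pref_domains V D R"
    and "\<And>i. i \<in> {1..n} \<Longrightarrow> \<Psi> i \<subseteq> language V D"
    and "\<And>i. i \<in> {1..n} \<Longrightarrow> nontrivial V R (\<Psi> i)"
  shows "(\<exists>\<Phi>. middle_ground V D R n \<Psi> \<Phi>) \<longleftrightarrow>
    (\<exists>\<phi> \<in> {Geq (alt_one_at V v) (alt_zero_at V v) | v. v \<in> V} \<union>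
            {Gt (alt_one_at V v) (alt_zero V) | v. v \<in> V}.
       P3 V R n \<Psi> {\<phi>} \<and> P4 V R n \<Psi> {\<phi>})"
  unfolding weakest_statements_def[symmetric]
proof
  assume "\<exists>\<Phi>. middle_ground V D R n \<Psi> \<Phi>"
  then obtain \<Phi> where \<Phi>: "\<Phi> \<subseteq> language V D" "P1 V R \<Phi>" "P3 V R n \<Psi> \<Phi>" "P4 V R n \<Psi> \<Phi>"
    unfolding middle_ground_def by blast
  then obtain \<phi> \<pi> where \<phi>: "\<phi> \<in> \<Phi>" "\<pi> \<in> lex_models V" "\<not> sat R \<pi> \<phi>"
    unfolding P1_def nontrivial_def falsifiable_def sat_set_def by blast
  then obtain \<chi> where \<chi>: "\<chi> \<in> weakest_statements V" "entails V R {\<phi>} {\<chi>}"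
    using falsifiable_entails_weakest[OF assms(1)] \<Phi>(1) by blast
  have "P3 V R n \<Psi> {\<phi>}" "P4 V R n \<Psi> {\<phi>}"
    using \<Phi>(3,4) \<phi>(1) by (auto simp: P3_def P4_def)
  then show "\<exists>\<phi>\<in>weakest_statements V. P3 V R n \<Psi> {\<phi>} \<and> P4 V R n \<Psi> {\<phi>}"
    using P3_weaken P4_weaken \<chi> by blast
next
  assume "\<exists>\<phi>\<in>weakest_statements V. P3 V R n \<Psi> {\<phi>} \<and> P4 V R n \<Psi> {\<phi>}"
  then obtain \<phi> where \<phi>: "\<phi> \<in> weakest_statements V" "P3 V R n \<Psi> {\<phi>}" "P4 V R n \<Psi> {\<phi>}"
    by blast
  \<comment> \<open>(P4) for a singleton supplies an index, which excludes the empty family.\<close>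
  have "n \<ge> 1"
    using \<phi>(3) by (auto simp: P4_def)
  show "\<exists>\<Phi>. middle_ground V D R n \<Psi> \<Phi>"
  proof (cases "consistent V R (\<Union>i\<in>{1..n}. \<Psi> i)")
    case True
    then show ?thesis
      using middle_ground_union assms(2,3) \<open>n \<ge> 1\<close> by blast
  next
    case False
    let ?Q = "\<lambda>\<Phi>. \<Phi> \<subseteq> language V D \<and>
      P1 V R \<Phi> \<and> P2 V R n \<Psi> \<Phi> \<and> P3 V R n \<Psi> \<Phi> \<and> P4 V R n \<Psi> \<Phi>"
    \<comment> \<open>A falsifiable set is non-empty, so (P3) has a partner statement to apply to
      and yields a model of \<open>\<phi>\<close>.\<close>
    have "\<exists>\<psi>. \<psi> \<in> \<Psi> 1"
      using assms(3)[of 1] \<open>n \<ge> 1\<close> by (auto simp: nontrivial_def falsifiable_def sat_set_def)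
    then have "consistent V R {\<phi>}"
      using \<phi>(2) \<open>n \<ge> 1\<close> by (fastforce simp: P3_def consistent_def sat_set_def)
    then have "P1 V R {\<phi>}"
      using weakest_statements_falsifiable[OF assms(1) \<phi>(1)] by (simp add: P1_def nontrivial_def)
    \<comment> \<open>(P2) holds vacuously, the union being inconsistent here.\<close>
    then have "?Q {\<phi>}"
      using \<phi> False weakest_statements_language[OF assms(1)] by (auto simp: P2_def)
    then obtain \<Phi> where "?Q \<Phi>"
        "\<forall>\<Phi>'. ?Q \<Phi>' \<longrightarrow> entails V R \<Phi>' \<Phi> \<longrightarrow> entails V R \<Phi> \<Phi>'"
      using exists_strongest[OF finite_language[OF assms(1)], of ?Q "{\<phi>}" V R] by auto
    then have "middle_ground V D R n \<Psi> \<Phi>"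
      unfolding middle_ground_def P5_def by blast
    then show ?thesis ..
  qed
qed

end
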